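(* Consider the squared loss $l(x,y)=(x-y)^2$ and $K=2$ experts. There exists an absolute constant $c_1>0$ such that for every $T>0$ and every learning rule which observes both experts' advice and the target in each of $T$ training rounds ($m=2$) and then outputs a prediction $\hat g$ that uses a single expert ($p=1$, i.e. $\hat g\in\{F_1,F_2\}$, chosen depending on the training data), there exists a probability distribution for the experts $\{F_1,F_2\}$ and the target variable $Y$ (all bounded by $1$) such that, with probability at least $0.1$ over the training phase, $$R(\hat g)-R^*\ge\frac{c_1}{\sqrt T}.$$
   Context: $T$ is an integer. The experts $F_1,F_2$ and the target $Y$ are real-valued, jointly distributed random variables; the training data $(Y_t,F_{1,t},F_{2,t})_{1\le t\le T}$ are i.i.d. copies of $(Y,F_1,F_2)$. The risk of a forecast $F$ is $R(F):=\mathbb{E}[l(F,Y)]$; for a training-data-dependent choice $\hat g$, $R(\hat g)$ is evaluated on a new draw of $(Y,F_1,F_2)$ independent of the training data (i.e. conditionally on the training data). $R^*:=\min\{R(F_1),R(F_2)\}$. $m$ denotes the number of expert advices that may be queried per training round and $p$ the number of experts that may be combined in the final prediction. *)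

theory Defs
  imports "HOL-Probability.Probability"
begin

text \<open>A draw of the triple \<open>(Y, F\<^sub>1, F\<^sub>2)\<close>.\<close>

type_synonym draw = "real \<times> real \<times> real"

datatype expert = Expert1 | Expert2

definition target :: "draw \<Rightarrow> real" where
  "target = (\<lambda>(y, f1, f2). y)"

fun advice :: "expert \<Rightarrow> draw \<Rightarrow> real" where
  "advice Expert1 (y, f1, f2) = f1"
| "advice Expert2 (y, f1, f2) = f2"

definition sq_loss :: "real \<Rightarrow> real \<Rightarrow> real" where
  "sq_loss x y = (x - y)\<^sup>2"

definition bounded_joint_law :: "draw measure \<Rightarrow> bool" where
  "bounded_joint_law P \<longleftrightarrow> prob_space P \<and> sets P = sets borel \<and>
     (AE z in P. \<bar>target z\<bar> \<le> 1 \<and> (\<forall>k. \<bar>advice k z\<bar> \<le> 1))"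

definition risk :: "draw measure \<Rightarrow> (draw \<Rightarrow> real) \<Rightarrow> real" where
  "risk P F = (\<integral>z. sq_loss (F z) (target z) \<partial>P)"

definition best_risk :: "draw measure \<Rightarrow> real" where
  "best_risk P = min (risk P (advice Expert1)) (risk P (advice Expert2))"

definition training_law :: "nat \<Rightarrow> draw measure \<Rightarrow> (nat \<Rightarrow> draw) measure" where
  "training_law T P = (\<Pi>\<^sub>M t\<in>{1..T}. P)"

text \<open>
  A rule sees the target and both advices in every round and selects one expert. Its prediction
  after training data \<open>D\<close> is \<open>advice (\<phi> D)\<close>; the risk of this forecast under \<open>P\<close>, with \<open>D\<close> held
  fixed, is its risk on a new draw conditionally on the training data.
\<close>

definition learning_rule :: "nat \<Rightarrow> ((nat \<Rightarrow> draw) \<Rightarrow> expert) \<Rightarrow> bool" where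
  "learning_rule T \<phi> \<longleftrightarrow> \<phi> \<in> (\<Pi>\<^sub>M t\<in>{1..T}. borel) \<rightarrow>\<^sub>M count_space UNIV"

end

theory Submission
  imports Defs
begin

text \<open>
  Le Cam's two-point method. Both experts are constant (\<open>1\<close> and \<open>-1\<close>) and the target is a random
  sign whose bias is \<open>\<epsilon> = 1 / (2 \<surd>T)\<close> towards one of them. Choosing the wrong expert costs an excess
  risk of \<open>4 \<epsilon>\<close>, while the Hellinger affinity of the two training laws has square
  \<open>(1 - \<epsilon>\<^sup>2)\<^sup>T \<ge> 3/4\<close>, so no rule can tell the two signs of the bias apart reliably.
\<close>

section \<open>Le Cam's inequality for finite sums and product measures\<close>

text \<open>With \<open>A\<close> the region where one decides for \<open>q\<close>, the right side
  is twice the sum of the two error probabilities. Cauchy-Schwarz on \<open>A\<close> and on its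
  complement separately yields products of a \<open>p\<close>-mass and a \<open>q\<close>-mass; in
  each the factor that is not an error is at most 1. Masses below 1 are allowed because the sums may
  later miss mass outside finitely many atoms.\<close>

lemma two_point_affinity_bound:
  fixes p q :: "'a \<Rightarrow> real"
  assumes "finite \<Omega>" "A \<subseteq> \<Omega>"
    and nonneg: "\<And>x. 0 \<le> p x" "\<And>x. 0 \<le> q x"
    and le1: "sum p \<Omega> \<le> 1" "sum q \<Omega> \<le> 1"
  shows "(\<Sum>x\<in>\<Omega>. sqrt (p x * q x))\<^sup>2 \<le> 2 * (sum p A + sum q (\<Omega> - A))"
proof -
  define \<rho> where "\<rho> B = (\<Sum>x\<in>B. sqrt (p x * q x))" for B
  have cs: "(\<rho> B)\<^sup>2 \<le> sum p B * sum q B" for B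
    using Cauchy_Schwarz_ineq_sum[of "\<lambda>x. sqrt (p x)" "\<lambda>x. sqrt (q x)" B] nonneg
    by (simp add: \<rho>_def real_sqrt_mult)
  have sub: "sum p (\<Omega> - A) \<le> 1" "sum q A \<le> 1"
    using le1 sum_mono2[OF \<open>finite \<Omega>\<close>, of "\<Omega> - A" p] sum_mono2[OF \<open>finite \<Omega>\<close> \<open>A \<subseteq> \<Omega>\<close>, of q] nonneg
    by auto
  have "(\<rho> A)\<^sup>2 \<le> sum p A"
    using cs[of A] mult_left_mono[OF sub(2), of "sum p A"] by (simp add: sum_nonneg nonneg)
  moreover have "(\<rho> (\<Omega> - A))\<^sup>2 \<le> sum q (\<Omega> - A)"
    using cs[of "\<Omega> - A"] mult_right_mono[OF sub(1), of "sum q (\<Omega> - A)"]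
    by (simp add: sum_nonneg nonneg)
  moreover have "\<rho> \<Omega> = \<rho> (\<Omega> - A) + \<rho> A"
    unfolding \<rho>_def by (rule sum.subset_diff) (use assms in auto)
  moreover have "(\<rho> (\<Omega> - A) + \<rho> A)\<^sup>2 \<le> 2 * ((\<rho> (\<Omega> - A))\<^sup>2 + (\<rho> A)\<^sup>2)"
    using zero_le_power2[of "\<rho> (\<Omega> - A) - \<rho> A"] by (simp add: power2_eq_square algebra_simps)
  ultimately show ?thesis
    unfolding \<rho>_def[of \<Omega>, symmetric] by (simp add: algebra_simps)
qed

text \<open>Bridge from finite sums to product measures: a single sequence is a box with singleton
  sides, and a finite \<open>B\<close> is a disjoint union of such boxes.\<close>

lemma sum_prod_singletons_PiM:
  fixes P :: "'a measure"
  assumes "prob_space P" "finite I" "finite B" "B \<subseteq> I \<rightarrow>\<^sub>E S"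
    and single: "\<And>z. z \<in> S \<Longrightarrow> {z} \<in> sets P"
  shows "B \<in> sets (\<Pi>\<^sub>M i\<in>I. P)"
    and "(\<Sum>\<omega>\<in>B. \<Prod>i\<in>I. measure P {\<omega> i}) = measure (\<Pi>\<^sub>M i\<in>I. P) B"
proof -
  interpret law: prob_space P by fact
  interpret finite_product_prob_space "\<lambda>_. P" I
    by unfold_locales (fact \<open>finite I\<close>)
  have point: "{\<omega>} = (\<Pi>\<^sub>E i\<in>I. {\<omega> i})" "\<And>i. i \<in> I \<Longrightarrow> {\<omega> i} \<in> sets P" if "\<omega> \<in> B" for \<omega>
  proof -
    have \<omega>: "\<omega> \<in> I \<rightarrow>\<^sub>E S"
      using that assms(4) by blast
    then show "{\<omega>} = (\<Pi>\<^sub>E i\<in>I. {\<omega> i})"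
      by (simp add: PiE_singleton PiE_iff)
    show "\<And>i. i \<in> I \<Longrightarrow> {\<omega> i} \<in> sets P"
      using \<omega> single by (simp add: PiE_iff)
  qed
  have sets: "{\<omega>} \<in> sets (\<Pi>\<^sub>M i\<in>I. P)" if "\<omega> \<in> B" for \<omega>
    using point[OF that] by (metis sets_PiM_I_finite \<open>finite I\<close>)
  have "(\<Union>\<omega>\<in>B. {\<omega>}) \<in> sets (\<Pi>\<^sub>M i\<in>I. P)"
    using sets \<open>finite B\<close> by blast
  then show "B \<in> sets (\<Pi>\<^sub>M i\<in>I. P)"
    by simp
  have "(\<Prod>i\<in>I. measure P {\<omega> i}) = measure (\<Pi>\<^sub>M i\<in>I. P) {\<omega>}" if "\<omega> \<in> B" for \<omega>
    using finite_measure_PiM_emb[of "\<lambda>i. {\<omega> i}"] point[OF that] by simp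
  then show "(\<Sum>\<omega>\<in>B. \<Prod>i\<in>I. measure P {\<omega> i}) = measure (\<Pi>\<^sub>M i\<in>I. P) B"
    using finite_measure_eq_sum_singleton[OF \<open>finite B\<close>] sets by simp
qed

text \<open>Affinity is multiplicative over independent rounds: expanding the power of the one-round
  sum gives the sum over all sequences in \<open>S\<close>. The factor 2 in the exponent is the
  square in the two-point bound.\<close>

lemma le_cam_product:
  fixes P Q :: "'a measure"
  assumes "prob_space P" "prob_space Q" and eq: "sets P = sets Q"
    and "finite I" "finite S" and single: "\<And>z. z \<in> S \<Longrightarrow> {z} \<in> sets P"
    and A: "A \<in> sets (\<Pi>\<^sub>M i\<in>I. P)"
  shows "(\<Sum>z\<in>S. sqrt (measure P {z} * measure Q {z})) ^ (2 * card I)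
    \<le> 2 * (measure (\<Pi>\<^sub>M i\<in>I. P) A + measure (\<Pi>\<^sub>M i\<in>I. Q) (space (\<Pi>\<^sub>M i\<in>I. Q) - A))"
proof -
  let ?P = "\<Pi>\<^sub>M i\<in>I. P" and ?Q = "\<Pi>\<^sub>M i\<in>I. Q"
  define \<Omega> where "\<Omega> = I \<rightarrow>\<^sub>E S"
  define p where "p \<omega> = (\<Prod>i\<in>I. measure P {\<omega> i})" for \<omega>
  define q where "q \<omega> = (\<Prod>i\<in>I. measure Q {\<omega> i})" for \<omega>
  interpret P: prob_space P by fact
  interpret Q: prob_space Q by fact
  interpret PP: prob_space ?P by (intro prob_space_PiM \<open>prob_space P\<close>)
  interpret QQ: prob_space ?Q by (intro prob_space_PiM \<open>prob_space Q\<close>)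
  have prod_sqrt: "(\<Prod>i\<in>I. sqrt (f i)) = sqrt (\<Prod>i\<in>I. f i)" for f :: "_ \<Rightarrow> real"
    by (induction I rule: infinite_finite_induct) (auto simp: real_sqrt_mult)
  have "finite \<Omega>"
    unfolding \<Omega>_def using assms by (intro finite_PiE)
  have pB: "sum p B = measure ?P B" and qB: "sum q B = measure ?Q B"
    and Bsets: "B \<in> sets ?Q" if "B \<subseteq> \<Omega>" for B
    using sum_prod_singletons_PiM[of P I B S] sum_prod_singletons_PiM[of Q I B S] assms that
      finite_subset[OF that \<open>finite \<Omega>\<close>] by (auto simp: p_def q_def \<Omega>_def)
  have "sets ?P = sets ?Q"
    by (intro sets_PiM_cong) (auto simp: eq)
  have "(\<Sum>\<omega>\<in>\<Omega>. sqrt (p \<omega> * q \<omega>)) = (\<Sum>\<omega>\<in>\<Omega>. \<Prod>i\<in>I. sqrt (measure P {\<omega> i} * measure Q {\<omega> i}))"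
    by (simp add: p_def q_def prod_sqrt prod.distrib)
  also have "\<dots> = (\<Sum>z\<in>S. sqrt (measure P {z} * measure Q {z})) ^ card I"
    using prod_sum_PiE[of I "\<lambda>_. S" "\<lambda>_ z. sqrt (measure P {z} * measure Q {z})"] assms
    by (simp add: \<Omega>_def)
  finally have "(\<Sum>z\<in>S. sqrt (measure P {z} * measure Q {z})) ^ (2 * card I)
      = (\<Sum>\<omega>\<in>\<Omega>. sqrt (p \<omega> * q \<omega>))\<^sup>2"
    by (simp add: power_mult[symmetric] mult.commute)
  also have "\<dots> \<le> 2 * (sum p (\<Omega> \<inter> A) + sum q (\<Omega> - \<Omega> \<inter> A))"
    using \<open>finite \<Omega>\<close> pB[of \<Omega>] qB[of \<Omega>]
    by (intro two_point_affinity_bound) (auto simp: p_def q_def prod_nonneg)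
  \<comment> \<open>Sequences outside \<open>\<Omega>\<close> were left out of the sums; restoring
    them only increases both error probabilities.\<close>
  also have "sum p (\<Omega> \<inter> A) \<le> measure ?P A"
    using A by (subst pB) (auto intro: PP.finite_measure_mono)
  also have "sum q (\<Omega> - \<Omega> \<inter> A) \<le> measure ?Q (space ?Q - A)"
    using A Bsets[of "\<Omega> - \<Omega> \<inter> A", THEN sets.sets_into_space] \<open>sets ?P = sets ?Q\<close>
    by (subst qB) (auto intro!: QQ.finite_measure_mono)
  finally show ?thesis
    by simp
qed

section \<open>A biased sign as target, with two constant experts\<close>

definition sign_draw :: "bool \<Rightarrow> draw" where
  "sign_draw b = (if b then 1 else - 1, 1, - 1)"

text \<open>For |\<epsilon>| \<le> 1 the parameter \<epsilon> is the mean of the target, so positive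
  \<epsilon> favours \<open>Expert1\<close> and changing its sign exchanges the roles of the
  experts.\<close>

definition sign_law :: "real \<Rightarrow> draw measure" where
  "sign_law \<epsilon> = distr (measure_pmf (bernoulli_pmf ((1 + \<epsilon>) / 2))) borel sign_draw"

lemma borel_measurable_target [measurable]: "target \<in> borel_measurable borel"
  unfolding target_def borel_prod[symmetric] by measurable

lemma borel_measurable_advice [measurable]: "advice k \<in> borel_measurable borel"
proof (cases k)
  case Expert1
  have eq: "advice Expert1 = (\<lambda>(y, f1, f2). f1)" by auto
  show ?thesis unfolding Expert1 eq borel_prod[symmetric] by measurable
next
  case Expert2
  have eq: "advice Expert2 = (\<lambda>(y, f1, f2). f2)" by auto
  show ?thesis unfolding Expert2 eq borel_prod[symmetric] by measurable
qed

lemma prob_space_sign_law: "prob_space (sign_law \<epsilon>)"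
  unfolding sign_law_def by (intro measure_pmf.prob_space_distr) simp

lemma sets_sign_law [simp]: "sets (sign_law \<epsilon>) = sets borel"
  by (simp add: sign_law_def)

lemma bounded_joint_law_sign_law: "bounded_joint_law (sign_law \<epsilon>)"
proof -
  have "\<forall>k. \<bar>advice k (sign_draw b)\<bar> \<le> 1" for b
  proof
    show "\<bar>advice k (sign_draw b)\<bar> \<le> 1" for k by (cases k) (auto simp: sign_draw_def)
  qed
  \<comment> \<open>Spelling out the quantifier over the two experts puts the event in a form that
    \<open>measurable\<close> can handle.\<close>
  moreover have eq: "(\<forall>k. R k) \<longleftrightarrow> R Expert1 \<and> R Expert2" for R
    by (metis expert.exhaust)
  have "{z \<in> space borel. \<bar>target z\<bar> \<le> 1 \<and> (\<forall>k. \<bar>advice k z\<bar> \<le> 1)} \<in> sets borel"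
    unfolding eq by measurable
  ultimately have "AE z in sign_law \<epsilon>. \<bar>target z\<bar> \<le> 1 \<and> (\<forall>k. \<bar>advice k z\<bar> \<le> 1)"
    unfolding sign_law_def by (subst AE_distr_iff) (auto simp: sign_draw_def target_def)
  then show ?thesis
    by (simp add: bounded_joint_law_def prob_space_sign_law)
qed

lemma measure_sign_law_singleton:
  assumes "\<bar>\<epsilon>\<bar> \<le> 1"
  shows "measure (sign_law \<epsilon>) {sign_draw b} = (if b then (1 + \<epsilon>) / 2 else (1 - \<epsilon>) / 2)"
proof -
  have "sign_draw -` {sign_draw b} = {b}"
    by (auto simp: sign_draw_def split: if_splits)
  with assms show ?thesis
    by (auto simp: sign_law_def measure_distr measure_pmf_single field_simps)
qed

text \<open>Each expert predicts a fixed sign, so its loss is 0 or 4 and its risk is 4 times the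
  probability of the opposite sign.\<close>

lemma risk_sign_law:
  assumes "\<bar>\<epsilon>\<bar> \<le> 1"
  shows "risk (sign_law \<epsilon>) (advice Expert1) = 2 * (1 - \<epsilon>)"
    and "risk (sign_law \<epsilon>) (advice Expert2) = 2 * (1 + \<epsilon>)"
proof -
  have eq: "risk (sign_law \<epsilon>) (advice k) =
    (\<integral>b. sq_loss (advice k (sign_draw b)) (target (sign_draw b)) \<partial>bernoulli_pmf ((1 + \<epsilon>) / 2))" for k
    unfolding risk_def sign_law_def sq_loss_def by (subst integral_distr) auto
  from assms show "risk (sign_law \<epsilon>) (advice Expert1) = 2 * (1 - \<epsilon>)"
      "risk (sign_law \<epsilon>) (advice Expert2) = 2 * (1 + \<epsilon>)"
    unfolding eq by (auto simp: integral_bernoulli_pmf sign_draw_def target_def sq_loss_def field_simps)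
qed

text \<open>The price of a wrong choice is linear in \<epsilon>, whereas the squared one-round
  affinity drops only by its square; this yields the rate 1 / \<surd>T.\<close>

lemma excess_risk_sign_law:
  assumes "0 \<le> \<epsilon>" "\<epsilon> \<le> 1"
  shows "risk (sign_law \<epsilon>) (advice Expert2) - best_risk (sign_law \<epsilon>) = 4 * \<epsilon>"
    and "risk (sign_law (- \<epsilon>)) (advice Expert1) - best_risk (sign_law (- \<epsilon>)) = 4 * \<epsilon>"
  using assms by (auto simp: best_risk_def risk_sign_law)

text \<open>Flipping the bias exchanges the masses of the two atoms, so both summands equal half of
  the right side.\<close>

lemma sign_law_affinity:
  assumes "\<bar>\<epsilon>\<bar> \<le> 1"
  shows "(\<Sum>z\<in>range sign_draw. sqrt (measure (sign_law \<epsilon>) {z} * measure (sign_law (- \<epsilon>)) {z}))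
    = sqrt (1 - \<epsilon>\<^sup>2)"
proof -
  have "inj sign_draw"
    by (auto simp: inj_def sign_draw_def split: if_splits)
  moreover have "(1 + \<epsilon>) / 2 * ((1 - \<epsilon>) / 2) = (1 - \<epsilon>\<^sup>2) / 4"
    by (simp add: field_simps power2_eq_square)
  ultimately show ?thesis
    using assms
    by (simp add: sum.reindex UNIV_bool measure_sign_law_singleton mult.commute real_sqrt_divide)
qed

section \<open>The lower bound for learning rules\<close>

lemma sign_law_two_point:
  assumes "learning_rule T \<phi>" "0 \<le> \<epsilon>" "\<epsilon> \<le> 1"
  defines "P \<equiv> training_law T (sign_law \<epsilon>)" and "Q \<equiv> training_law T (sign_law (- \<epsilon>))"
  shows "1 - real T * \<epsilon>\<^sup>2
    \<le> 2 * (measure P {D \<in> space P. \<phi> D = Expert2} + measure Q {D \<in> space Q. \<phi> D = Expert1})"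
proof -
  have e2: "\<epsilon>\<^sup>2 \<le> 1" using assms by (simp add: power_le_one)
  have sets: "sets P = sets (\<Pi>\<^sub>M t\<in>{1..T}. borel)" "sets Q = sets (\<Pi>\<^sub>M t\<in>{1..T}. borel)"
    unfolding P_def Q_def training_law_def by (auto intro!: sets_PiM_cong)
  note [measurable_cong] = sets
  have [measurable]: "\<phi> \<in> P \<rightarrow>\<^sub>M count_space UNIV"
    using assms(1) unfolding learning_rule_def measurable_cong_sets[OF sets(1) refl] .
  let ?A = "{D \<in> space P. \<phi> D = Expert2}"
  have "?A \<in> sets P" by measurable
  \<comment> \<open>A rule is a test between the two biases: choosing \<open>Expert2\<close> is the
    error under \<open>P\<close>, and the complementary event is the error under
    \<open>Q\<close>.\<close>
  have "space Q - ?A = {D \<in> space Q. \<phi> D = Expert1}"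
    using sets_eq_imp_space_eq[of P Q] sets by (auto intro: expert.exhaust)
  have "1 - real T * \<epsilon>\<^sup>2 \<le> (1 - \<epsilon>\<^sup>2) ^ T"
    using Bernoulli_inequality[of "- \<epsilon>\<^sup>2" T] e2 by simp
  also have "\<dots> = sqrt (1 - \<epsilon>\<^sup>2) ^ (2 * card {1..T})"
    using e2 by (simp add: power_mult)
  also have "\<dots> \<le> 2 * (measure P ?A + measure Q (space Q - ?A))"
    using le_cam_product[of "sign_law \<epsilon>" "sign_law (- \<epsilon>)" "{1..T}" "range sign_draw" ?A]
      \<open>?A \<in> sets P\<close> assms
    by (simp add: sign_law_affinity prob_space_sign_law P_def Q_def training_law_def)
  finally show ?thesis
    unfolding \<open>space Q - ?A = _\<close> .
qed

text \<open>Passes from the choice of a bad expert to a large excess risk: whenever the rule selects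
  \<open>k\<close>, the excess is at least \<open>c\<close>.\<close>

lemma measure_excess_risk_ge:
  assumes "learning_rule T \<phi>" "prob_space P" "sets P = sets borel"
    and "c \<le> risk P (advice k) - best_risk P"
  shows "measure (training_law T P) {D \<in> space (training_law T P). \<phi> D = k}
    \<le> measure (training_law T P)
        {D \<in> space (training_law T P). risk P (advice (\<phi> D)) - best_risk P \<ge> c}"
proof -
  interpret prob_space "training_law T P"
    unfolding training_law_def by (intro prob_space_PiM assms)
  have sets: "sets (training_law T P) = sets (\<Pi>\<^sub>M t\<in>{1..T}. borel)"
    unfolding training_law_def by (intro sets_PiM_cong) (auto simp: assms)
  have [measurable]: "\<phi> \<in> training_law T P \<rightarrow>\<^sub>M count_space UNIV"
    using assms(1) unfolding learning_rule_def measurable_cong_sets[OF sets refl] .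
  show ?thesis
    using assms by (intro finite_measure_mono) auto
qed

theorem lemma6p1:
  "\<exists>c1::real. c1 > 0 \<and>
    (\<forall>T::nat. T > 0 \<longrightarrow>
      (\<forall>\<phi>. learning_rule T \<phi> \<longrightarrow>
        (\<exists>P. bounded_joint_law P \<and>
          measure (training_law T P)
            {D \<in> space (training_law T P).
               risk P (advice (\<phi> D)) - best_risk P \<ge> c1 / sqrt (real T)} \<ge> 0.1)))"
proof (intro exI[of _ "2::real"] conjI allI impI)
  fix T :: nat and \<phi>
  assume "T > 0" and \<phi>: "learning_rule T \<phi>"
  \<comment> \<open>This size keeps T \<epsilon>^2 at 1/4, so the errors stay bounded away from 0,
    and makes the gap 4 \<epsilon> equal to 2 / \<surd>T, whence the constant 2.\<close>
  define \<epsilon> where "\<epsilon> = 1 / (2 * sqrt (real T))"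
  have "1 \<le> sqrt (real T) * 2"
    using \<open>T > 0\<close> real_sqrt_ge_one[of "real T"] by linarith
  then have \<epsilon>: "0 \<le> \<epsilon>" "\<epsilon> \<le> 1" "4 * \<epsilon> = 2 / sqrt (real T)" "real T * \<epsilon>\<^sup>2 = 1 / 4"
    using \<open>T > 0\<close> by (auto simp: \<epsilon>_def field_simps power_mult_distrib)
  let ?miss = "\<lambda>\<delta> k. measure (training_law T (sign_law \<delta>))
    {D \<in> space (training_law T (sign_law \<delta>)). \<phi> D = k}"
  have "3 / 4 \<le> 2 * (?miss \<epsilon> Expert2 + ?miss (- \<epsilon>) Expert1)"
    using sign_law_two_point[OF \<phi> \<epsilon>(1,2)] by (simp add: \<epsilon>(4))
  \<comment> \<open>The two errors sum to at least 3/8, so one of them is at least 3/16.\<close>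
  then have "0.1 \<le> ?miss \<epsilon> Expert2 \<or> 0.1 \<le> ?miss (- \<epsilon>) Expert1"
    by (auto simp: not_le)
  \<comment> \<open>The hard law depends on the rule: \<delta> is a bias that the rule misjudges
    often enough, and \<open>k\<close> is the inferior expert under it.\<close>
  then obtain \<delta> k where miss: "0.1 \<le> ?miss \<delta> k"
    and excess: "2 / sqrt (real T) \<le> risk (sign_law \<delta>) (advice k) - best_risk (sign_law \<delta>)"
  proof
    assume "0.1 \<le> ?miss \<epsilon> Expert2"
    then show thesis
      by (rule that) (simp add: excess_risk_sign_law \<epsilon>)
  next
    assume "0.1 \<le> ?miss (- \<epsilon>) Expert1"
    then show thesis
      by (rule that) (simp add: excess_risk_sign_law \<epsilon>)
  qed
  show "\<exists>P. bounded_joint_law P \<and>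
      measure (training_law T P)
        {D \<in> space (training_law T P).
           risk P (advice (\<phi> D)) - best_risk P \<ge> 2 / sqrt (real T)} \<ge> 0.1"
    using bounded_joint_law_sign_law order_trans[OF miss
        measure_excess_risk_ge[OF \<phi> prob_space_sign_law sets_sign_law excess]]
    by (intro exI[of _ "sign_law \<delta>"] conjI)
qed simp

end
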